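(* Let $A$ be a Conley attractor of an iterated function system $\mathcal{F}$ on a metric space $\mathbb{X}$ and let $B$ be the basin of $A$. If $\mathcal{F}$ is contractive on $B$, then $A$ is a strict attractor of $\mathcal{F}$ with basin $B$.
   Context: An iterated function system (IFS) $\mathcal{F} = (\mathbb{X}; f_1,\dots,f_N)$ on a metric space $(\mathbb{X},d)$ is a finite collection of continuous functions $f_n : \mathbb{X}\to\mathbb{X}$, $n=1,\dots,N$. The same symbol denotes the map on subsets $\mathcal{F}(S) = \bigcup_{f\in\mathcal{F}} f(S)$, and $\mathcal{F}^k$ is its $k$-fold composition. $\mathbb{H}(U)$ denotes the set of nonempty compact subsets of $U$. The Hausdorff distance is $d_{\mathbb{H}}(S,T)=\inf\{r>0 : S\subset T_r \text{ and } T\subset S_r\}$, where $S_r$ is the set of points at distance less than $r$ from some point of $S$; limits of sets are with respect to it. A compact set $A\subset\mathbb{X}$ is a Conley attractor of $\mathcal{F}$ if there is an open set $U$ with $A\subset U$ and $A=\lim_{k\to\infty}\mathcal{F}^k(\overline{U})$. Its basin (as a Conley attractor) is the union of all open sets $U$ with this property. A nonempty compact set $A\subset\mathbb{X}$ is a strict attractor of $\mathcal{F}$ if (i) $\mathcal{F}(A)=A$ and (ii) there is an open set $U\subset\mathbb{X}$ such that $A\subset U$ and $\lim_{k\to\infty}\mathcal{F}^k(S)=A$ for all $S\in\mathbb{H}(U)$. The largest open set $U$ for which (ii) holds is called the basin of the strict attractor $A$. $\mathcal{F}$ is contractive on $B$ if the functions of $\mathcal{F}$, restricted to $B$, are strict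 contractions for some metric inducing the same topology: there are a metric $\hat d$ on $B$ inducing the same topology on $B$ as $d$ and a constant $\lambda\in[0,1)$ such that $\hat d(f(x),f(y))\le\lambda\,\hat d(x,y)$ for all $x,y\in B$ and all $f\in\mathcal{F}$.
   Formalization: The attractor A is assumed nonempty: by the literal definition the empty set is a Conley attractor with empty basin, on which the system is vacuously contractive, but a strict attractor must be nonempty. *)

theory Defs
  imports "HOL-Analysis.Analysis"
begin

text \<open>The ambient metric space is the universe of a type of class \<^class>\<open>metric_space\<close>.
  A finite system with no maps at all is not excluded here; it admits no nonempty attractor
  of either kind.\<close>

definition is_IFS :: "('a::metric_space \<Rightarrow> 'a) set \<Rightarrow> bool" where
  "is_IFS F \<longleftrightarrow> finite F \<and> (\<forall>f\<in>F. continuous_on UNIV f)"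

definition ifs_map :: "('a \<Rightarrow> 'a) set \<Rightarrow> 'a set \<Rightarrow> 'a set" where
  "ifs_map F S = (\<Union>f\<in>F. f ` S)"

definition set_nbhd :: "real \<Rightarrow> 'a::metric_space set \<Rightarrow> 'a set" where
  "set_nbhd r S = {x. \<exists>y\<in>S. dist x y < r}"

text \<open>The distance takes values in \<^typ>\<open>ennreal\<close>, so that it is infinite (rather than an
  unspecified real) when no radius qualifies; the sets need be neither compact nor bounded.\<close>

definition hausdorff_dist :: "'a::metric_space set \<Rightarrow> 'a set \<Rightarrow> ennreal" where
  "hausdorff_dist S T = Inf {ennreal r | r. 0 < r \<and> S \<subseteq> set_nbhd r T \<and> T \<subseteq> set_nbhd r S}"

definition set_lim :: "(nat \<Rightarrow> 'a::metric_space set) \<Rightarrow> 'a set \<Rightarrow> bool" where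
  "set_lim S A \<longleftrightarrow> (\<lambda>k. hausdorff_dist (S k) A) \<longlonglongrightarrow> 0"

definition conley_nbhd :: "('a::metric_space \<Rightarrow> 'a) set \<Rightarrow> 'a set \<Rightarrow> 'a set \<Rightarrow> bool" where
  "conley_nbhd F A U \<longleftrightarrow>
     open U \<and> A \<subseteq> U \<and> set_lim (\<lambda>k. (ifs_map F ^^ k) (closure U)) A"

text \<open>With this definition the empty set is always a Conley attractor; its basin
  is empty unless the system has no maps.\<close>

definition conley_attractor :: "('a::metric_space \<Rightarrow> 'a) set \<Rightarrow> 'a set \<Rightarrow> bool" where
  "conley_attractor F A \<longleftrightarrow> compact A \<and> (\<exists>U. conley_nbhd F A U)"

definition conley_basin :: "('a::metric_space \<Rightarrow> 'a) set \<Rightarrow> 'a set \<Rightarrow> 'a set" where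
  "conley_basin F A = \<Union>{U. conley_nbhd F A U}"

definition strict_nbhd :: "('a::metric_space \<Rightarrow> 'a) set \<Rightarrow> 'a set \<Rightarrow> 'a set \<Rightarrow> bool" where
  "strict_nbhd F A U \<longleftrightarrow>
     open U \<and> A \<subseteq> U \<and>
     (\<forall>S. S \<noteq> {} \<and> compact S \<and> S \<subseteq> U \<longrightarrow> set_lim (\<lambda>k. (ifs_map F ^^ k) S) A)"

definition strict_attractor :: "('a::metric_space \<Rightarrow> 'a) set \<Rightarrow> 'a set \<Rightarrow> bool" where
  "strict_attractor F A \<longleftrightarrow>
     A \<noteq> {} \<and> compact A \<and> ifs_map F A = A \<and> (\<exists>U. strict_nbhd F A U)"

definition is_strict_basin :: "('a::metric_space \<Rightarrow> 'a) set \<Rightarrow> 'a set \<Rightarrow> 'a set \<Rightarrow> bool" where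
  "is_strict_basin F A B \<longleftrightarrow> strict_nbhd F A B \<and> (\<forall>U. strict_nbhd F A U \<longrightarrow> U \<subseteq> B)"

text \<open>Only the values of \<open>d'\<close> on \<open>B \<times> B\<close> are meaningful. That the maps send \<open>B\<close> into
  itself is not part of the definition; basins of Conley attractors are forward invariant.\<close>

definition contractive_on :: "('a::metric_space \<Rightarrow> 'a) set \<Rightarrow> 'a set \<Rightarrow> bool" where
  "contractive_on F B \<longleftrightarrow>
     (\<exists>d' l. Metric_space B d' \<and> Metric_space.mtopology B d' = top_of_set B \<and>
        0 \<le> l \<and> l < (1::real) \<and>
        (\<forall>f\<in>F. \<forall>x\<in>B. \<forall>y\<in>B. d' (f x) (f y) \<le> l * d' x y))"

end

theory Submission
  imports Defs
begin

text \<open>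
  A point belongs to the Conley basin as soon as some \<open>F\<^sup>m\<close> sends it into a Conley
  neighbourhood \<open>U\<close>: by continuity \<open>F\<^sup>m\<close> sends a small closed ball around it into \<open>U\<close>, and
  adding the ball to \<open>U\<close> does not change the limit. Hence the basin is forward invariant and
  contains every strict neighbourhood. If \<open>S \<subseteq> B\<close> is nonempty and compact, finitely many Conley
  neighbourhoods cover \<open>S\<close>, so \<open>F\<^sup>k S\<close> gets close to \<open>A\<close>. Conversely \<open>A = F\<^sup>k A\<close>, and the orbit of a
  single point of \<open>S\<close> under the same words of length \<open>k\<close> approximates the points of \<open>A\<close> by
  contractivity.
\<close>

section \<open>Neighbourhoods and Hausdorff convergence\<close>

lemma set_nbhd_mono: "r \<le> s \<Longrightarrow> S \<subseteq> T \<Longrightarrow> set_nbhd r S \<subseteq> set_nbhd s T"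
  unfolding set_nbhd_def by force

lemma set_nbhd_eq_UN_ball: "set_nbhd r S = (\<Union>x\<in>S. ball x r)"
  by (auto simp: set_nbhd_def dist_commute)

lemma compact_set_nbhd_subset_open:
  assumes "compact A" "open V" "A \<subseteq> V"
  obtains e where "e > 0" "set_nbhd e A \<subseteq> V"
  using compact_subset_open_imp_ball_epsilon_subset[OF assms]
  unfolding set_nbhd_eq_UN_ball by blast

lemma set_nbhd_subset_imp_closure:
  assumes "\<And>e. e > 0 \<Longrightarrow> x \<in> set_nbhd e A"
  shows "x \<in> closure A"
  using assms by (auto simp: set_nbhd_def closure_approachable dist_commute)

lemma hausdorff_dist_less_iff:
  "hausdorff_dist S T < c \<longleftrightarrow>
     (\<exists>r>0. ennreal r < c \<and> S \<subseteq> set_nbhd r T \<and> T \<subseteq> set_nbhd r S)"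
  unfolding hausdorff_dist_def Inf_less_iff by blast

text \<open>Any admissible radius may be enlarged, so the two inclusions decouple into an upper and
  a lower half of the limit. Keeping them apart matters because they are later proved by different
  arguments.\<close>

lemma set_lim_iff:
  "set_lim S A \<longleftrightarrow>
     (\<forall>e>0. \<forall>\<^sub>F k in sequentially. S k \<subseteq> set_nbhd e A) \<and>
     (\<forall>e>0. \<forall>\<^sub>F k in sequentially. A \<subseteq> set_nbhd e (S k))"
  (is "_ \<longleftrightarrow> ?R")
proof
  assume L: "set_lim S A"
  have "\<forall>\<^sub>F k in sequentially. S k \<subseteq> set_nbhd e A \<and> A \<subseteq> set_nbhd e (S k)" if "e > 0" for e
  proof -
    have "\<forall>\<^sub>F k in sequentially. hausdorff_dist (S k) A < ennreal e"
      using order_tendstoD(2)[OF L[unfolded set_lim_def]] that by simp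
    then show ?thesis
    proof eventually_elim
      case (elim k)
      then obtain r where r: "r > 0" "ennreal r < ennreal e"
          "S k \<subseteq> set_nbhd r A" "A \<subseteq> set_nbhd r (S k)"
        unfolding hausdorff_dist_less_iff by blast
      then have "r \<le> e"
        by (simp add: ennreal_less_iff)
      then show ?case
        using r set_nbhd_mono by blast
    qed
  qed
  then show ?R
    by (simp add: eventually_conj_iff)
next
  assume R: ?R
  show "set_lim S A"
    unfolding set_lim_def
  proof (rule tendsto_zero_ennreal)
    fix r :: real
    assume r: "r > 0"
    then have "\<forall>\<^sub>F k in sequentially. S k \<subseteq> set_nbhd (r/2) A"
      and "\<forall>\<^sub>F k in sequentially. A \<subseteq> set_nbhd (r/2) (S k)"
      using R by simp_all
    then show "\<forall>\<^sub>F k in sequentially. hausdorff_dist (S k) A < ennreal r"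
    proof eventually_elim
      case (elim k)
      then show ?case
        \<comment> \<open>The witness must lie strictly below \<open>r\<close>, hence the passage to
          \<open>r/2\<close>.\<close>
        unfolding hausdorff_dist_less_iff using r
        by (intro exI[of _ "r/2"]) (auto simp: ennreal_less_iff)
    qed
  qed
qed

section \<open>Iterates of the set map\<close>

lemma ifs_map_funpow_mono: "S \<subseteq> T \<Longrightarrow> (ifs_map F ^^ k) S \<subseteq> (ifs_map F ^^ k) T"
  by (induction k) (auto simp: ifs_map_def)

lemma ifs_map_funpow_Un:
  "(ifs_map F ^^ k) (S \<union> T) = (ifs_map F ^^ k) S \<union> (ifs_map F ^^ k) T"
  by (induction k) (auto simp: ifs_map_def)

lemma ifs_map_funpow_fixed: "ifs_map F A = A \<Longrightarrow> (ifs_map F ^^ k) A = A"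
  by (induction k) auto

text \<open>\<open>V\<close> consists of the points that every word of length \<open>m\<close> sends
  into \<open>U\<close>. It is open because each step intersects only finitely many preimages under
  continuous maps.\<close>

lemma ifs_map_funpow_preimage:
  assumes "is_IFS F" "open U"
  obtains V where "open V" "\<And>S. (ifs_map F ^^ m) S \<subseteq> U \<longleftrightarrow> S \<subseteq> V"
proof -
  have "\<exists>V. open V \<and> (\<forall>S. (ifs_map F ^^ m) S \<subseteq> U \<longleftrightarrow> S \<subseteq> V)"
  proof (induction m)
    case 0
    then show ?case
      using assms by auto
  next
    case (Suc m)
    then obtain V where V: "open V" "\<And>S. (ifs_map F ^^ m) S \<subseteq> U \<longleftrightarrow> S \<subseteq> V"
      by blast
    have "open (\<Inter>f\<in>F. f -` V)"
      using assms V(1) unfolding is_IFS_def by (intro open_INT ballI) (auto intro: open_vimage)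
    moreover have "(ifs_map F ^^ Suc m) S \<subseteq> U \<longleftrightarrow> S \<subseteq> (\<Inter>f\<in>F. f -` V)" for S
      \<comment> \<open>Splitting off the map applied first lets the hypothesis for
        \<open>m\<close>, valid for every set, be used at \<open>ifs_map F S\<close>.\<close>
      unfolding funpow_Suc_right comp_apply V(2) by (auto simp: ifs_map_def)
    ultimately show ?case
      by blast
  qed
  then show ?thesis
    using that by blast
qed

lemma compact_ifs_map: "is_IFS F \<Longrightarrow> compact A \<Longrightarrow> compact (ifs_map F A)"
  unfolding ifs_map_def is_IFS_def
  by (intro compact_UN compact_continuous_image) (auto intro: continuous_on_subset)

section \<open>Invariance of Conley attractors\<close>

text \<open>Shifting the index does not change the limit of the iterates of
  \<open>closure U\<close>, and continuity lets \<open>ifs_map F\<close> pass to that limit. Compact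
  sets being closed, approximation at every scale gives membership.\<close>

lemma conley_attractor_invariant:
  assumes F: "is_IFS F" and A: "compact A" and U: "conley_nbhd F A U"
  shows "ifs_map F A = A"
proof
  let ?G = "\<lambda>k. (ifs_map F ^^ k) (closure U)"
  have up: "\<forall>\<^sub>F k in sequentially. ?G k \<subseteq> set_nbhd e A"
    and low: "\<forall>\<^sub>F k in sequentially. A \<subseteq> set_nbhd e (?G k)" if "e > 0" for e
    using U that unfolding conley_nbhd_def set_lim_iff by auto
  show "ifs_map F A \<subseteq> A"
  proof
    fix y
    assume "y \<in> ifs_map F A"
    then obtain f x where fx: "f \<in> F" "x \<in> A" "y = f x"
      by (auto simp: ifs_map_def)
    have "y \<in> closure A"
    proof (rule set_nbhd_subset_imp_closure)
      fix e :: real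
      assume e: "e > 0"
      have "continuous_on UNIV f"
        using F fx by (auto simp: is_IFS_def)
      then obtain d where d: "d > 0" "\<And>z. dist z x < d \<Longrightarrow> dist (f z) (f x) < e/2"
        unfolding continuous_on_iff using e by (metis UNIV_I half_gt_zero)
      have "\<forall>\<^sub>F k in sequentially. A \<subseteq> set_nbhd d (?G k) \<and> ?G (Suc k) \<subseteq> set_nbhd (e/2) A"
        using e
        by (intro eventually_conj low d(1) eventually_sequentially_Suc[THEN iffD2, OF up]) simp
      then obtain k where k: "A \<subseteq> set_nbhd d (?G k)" "?G (Suc k) \<subseteq> set_nbhd (e/2) A"
        using eventually_happens'[OF sequentially_bot] by fast
      \<comment> \<open>\<open>?G k\<close> supplies a point near \<open>x\<close>; its image lies
        in the next iterate, which is already close to \<open>A\<close>.\<close>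
      obtain z where z: "z \<in> ?G k" "dist x z < d"
        using k(1) fx by (auto simp: set_nbhd_def)
      have "f z \<in> ?G (Suc k)"
        using z fx by (auto simp: ifs_map_def)
      then obtain a where a: "a \<in> A" "dist (f z) a < e/2"
        using k(2) by (auto simp: set_nbhd_def)
      have "dist (f z) (f x) < e/2"
        using d(2)[of z] z(2) dist_commute[of x z] by simp
      then have "dist y a < e"
        using a(2) dist_triangle_half_r fx(3) by metis
      then show "y \<in> set_nbhd e A"
        using a by (auto simp: set_nbhd_def)
    qed
    then show "y \<in> A"
      using A by (simp add: compact_imp_closed)
  qed
  show "A \<subseteq> ifs_map F A"
  proof
    fix a
    assume a: "a \<in> A"
    have "a \<in> closure (ifs_map F A)"
    proof (rule set_nbhd_subset_imp_closure)
      fix e :: real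
      assume e: "e > 0"
      \<comment> \<open>Here a single radius must serve all of \<open>A\<close>; compactness
        extracts it from an open preimage around \<open>A\<close>.\<close>
      have "open (set_nbhd (e/2) (ifs_map F A))"
        by (auto simp: set_nbhd_eq_UN_ball)
      then obtain V where V: "open V"
          "\<And>S. (ifs_map F ^^ 1) S \<subseteq> set_nbhd (e/2) (ifs_map F A) \<longleftrightarrow> S \<subseteq> V"
        using ifs_map_funpow_preimage[OF F] by metis
      have "ifs_map F A \<subseteq> set_nbhd (e/2) (ifs_map F A)"
        using e by (auto simp: set_nbhd_eq_UN_ball)
      then have "A \<subseteq> V"
        using V(2)[of A] by simp
      then obtain d where d: "d > 0" "set_nbhd d A \<subseteq> V"
        using compact_set_nbhd_subset_open[OF A V(1)] by blast
      have "\<forall>\<^sub>F k in sequentially. ?G k \<subseteq> set_nbhd d A \<and> A \<subseteq> set_nbhd (e/2) (?G (Suc k))"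
        using e
        by (intro eventually_conj up d(1) eventually_sequentially_Suc[THEN iffD2, OF low]) simp
      then obtain k where k: "?G k \<subseteq> set_nbhd d A" "A \<subseteq> set_nbhd (e/2) (?G (Suc k))"
        using eventually_happens'[OF sequentially_bot] by fast
      have "?G (Suc k) \<subseteq> set_nbhd (e/2) (ifs_map F A)"
        using V(2)[of "?G k"] k(1) d(2) by auto
      moreover obtain z where z: "z \<in> ?G (Suc k)" "dist a z < e/2"
        using k(2) a unfolding set_nbhd_def by blast
      ultimately obtain b where b: "b \<in> ifs_map F A" "dist z b < e/2"
        unfolding set_nbhd_def by blast
      have "dist a b < e"
        using dist_triangle_half_r[of z a e b] z b by (simp add: dist_commute)
      then show "a \<in> set_nbhd e (ifs_map F A)"
        using b by (auto simp: set_nbhd_def)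
    qed
    then show "a \<in> ifs_map F A"
      using compact_ifs_map[OF F A] by (simp add: compact_imp_closed)
  qed
qed

section \<open>The basin of a Conley attractor\<close>

lemma conley_basin_memI:
  assumes F: "is_IFS F" and U: "conley_nbhd F A U" and x: "(ifs_map F ^^ m) {x} \<subseteq> U"
  shows "x \<in> conley_basin F A"
proof -
  have up: "\<forall>\<^sub>F k in sequentially. (ifs_map F ^^ k) (closure U) \<subseteq> set_nbhd e A"
    and low: "\<forall>\<^sub>F k in sequentially. A \<subseteq> set_nbhd e ((ifs_map F ^^ k) (closure U))"
    if "e > 0" for e
    using U that unfolding conley_nbhd_def set_lim_iff by auto
  have "open U"
    using U by (simp add: conley_nbhd_def)
  then obtain V where V: "open V" "\<And>S. (ifs_map F ^^ m) S \<subseteq> U \<longleftrightarrow> S \<subseteq> V"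
    using ifs_map_funpow_preimage[OF F] by metis
  have "x \<in> V"
    using V(2) x by blast
  \<comment> \<open>\<open>conley_nbhd\<close> tests closures, so the closed ball, not just the open
    one, has to fit into \<open>V\<close>.\<close>
  then obtain r where r: "r > 0" "cball x r \<subseteq> V"
    using V(1) open_contains_cball by blast
  let ?W = "ball x r"
  have "closure ?W \<subseteq> V"
    using r closure_minimal[OF ball_subset_cball closed_cball, of x r] by blast
  then have W: "(ifs_map F ^^ m) (closure ?W) \<subseteq> closure U"
    using V(2) closure_subset by blast
  \<comment> \<open>Closure and iterates distribute over the union, so the lower half is inherited
    from \<open>U\<close> and only the upper half for \<open>?W\<close> is new.\<close>
  have "conley_nbhd F A (?W \<union> U)"
    unfolding conley_nbhd_def set_lim_iff
  proof (intro conjI allI impI)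
    show "open (?W \<union> U)" "A \<subseteq> ?W \<union> U"
      using U by (auto simp: conley_nbhd_def)
    fix e :: real
    assume e: "e > 0"
    have "\<forall>\<^sub>F k in sequentially. (ifs_map F ^^ (k + m)) (closure ?W) \<subseteq> set_nbhd e A"
      using up[OF e]
    proof eventually_elim
      case (elim k)
      then show ?case
        using ifs_map_funpow_mono[OF W] by (auto simp: funpow_add)
    qed
    then have "\<forall>\<^sub>F k in sequentially. (ifs_map F ^^ k) (closure ?W) \<subseteq> set_nbhd e A"
      \<comment> \<open>The ball trails \<open>closure U\<close> by \<open>m\<close> steps; a fixed
        delay does not affect an eventual statement.\<close>
      using eventually_sequentially_seg by blast
    then show "\<forall>\<^sub>F k in sequentially. (ifs_map F ^^ k) (closure (?W \<union> U)) \<subseteq> set_nbhd e A"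
      using up[OF e] by eventually_elim (simp add: closure_Un ifs_map_funpow_Un)
    show "\<forall>\<^sub>F k in sequentially. A \<subseteq> set_nbhd e ((ifs_map F ^^ k) (closure (?W \<union> U)))"
      using low[OF e]
    proof eventually_elim
      case (elim k)
      then show ?case
        unfolding closure_Un ifs_map_funpow_Un
        using set_nbhd_mono[OF order_refl Un_upper2] by (rule subset_trans)
    qed
  qed
  then show ?thesis
    unfolding conley_basin_def using r by (auto intro!: exI[of _ "?W \<union> U"])
qed

lemma set_lim_eventually_subset_open:
  assumes "set_lim S A" "compact A" "open U" "A \<subseteq> U"
  shows "\<forall>\<^sub>F k in sequentially. S k \<subseteq> U"
proof -
  obtain e where e: "e > 0" "set_nbhd e A \<subseteq> U"
    using compact_set_nbhd_subset_open assms by blast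
  have "\<forall>\<^sub>F k in sequentially. S k \<subseteq> set_nbhd e A"
    using assms(1) e(1) by (simp add: set_lim_iff)
  then show ?thesis
    by eventually_elim (use e in blast)
qed

text \<open>The orbit of \<open>f x\<close> runs one step ahead inside the iterates of
  \<open>closure U\<close>, which are eventually swallowed by \<open>U\<close>.\<close>

lemma conley_basin_forward_invariant:
  assumes F: "is_IFS F" and A: "compact A" and x: "x \<in> conley_basin F A" and f: "f \<in> F"
  shows "f x \<in> conley_basin F A"
proof -
  obtain U where U: "conley_nbhd F A U" "x \<in> U"
    using x by (auto simp: conley_basin_def)
  have "\<forall>\<^sub>F k in sequentially. (ifs_map F ^^ k) (closure U) \<subseteq> U"
    using U A by (intro set_lim_eventually_subset_open) (auto simp: conley_nbhd_def)
  \<comment> \<open>The inclusion is kept for all \<open>k \<ge> m\<close> because it is used at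
    \<open>Suc m\<close>.\<close>
  then obtain m where m: "\<And>k. k \<ge> m \<Longrightarrow> (ifs_map F ^^ k) (closure U) \<subseteq> U"
    by (auto simp: eventually_sequentially)
  have "{f x} \<subseteq> ifs_map F (closure U)"
    using U f closure_subset by (fastforce simp: ifs_map_def)
  then have "(ifs_map F ^^ m) {f x} \<subseteq> (ifs_map F ^^ Suc m) (closure U)"
    using ifs_map_funpow_mono[of "{f x}" "ifs_map F (closure U)" m F]
    by (simp only: funpow_Suc_right comp_apply)
  then show ?thesis
    using conley_basin_memI[OF F U(1)] m[of "Suc m"] by fastforce
qed

text \<open>Singletons are compact, so the orbit of each point of \<open>U\<close> converges to
  \<open>A\<close> and must enter the Conley neighbourhood \<open>C\<close>. This yields the
  maximality of the basin.\<close>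

lemma strict_nbhd_subset_conley_basin:
  assumes F: "is_IFS F" and A: "compact A" and C: "conley_nbhd F A C" and U: "strict_nbhd F A U"
  shows "U \<subseteq> conley_basin F A"
proof
  fix x
  assume "x \<in> U"
  then have "set_lim (\<lambda>k. (ifs_map F ^^ k) {x}) A"
    using U by (simp add: strict_nbhd_def)
  then have "\<forall>\<^sub>F k in sequentially. (ifs_map F ^^ k) {x} \<subseteq> C"
    using C A by (intro set_lim_eventually_subset_open) (auto simp: conley_nbhd_def)
  then obtain m where "(ifs_map F ^^ m) {x} \<subseteq> C"
    using eventually_happens'[OF sequentially_bot] by fast
  then show "x \<in> conley_basin F A"
    by (rule conley_basin_memI[OF F C])
qed

section \<open>Convergence of compact subsets of the basin\<close>

lemma ifs_map_funpow_compact_near_attractor: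
  assumes S: "compact S" "S \<subseteq> conley_basin F A" and e: "e > 0"
  shows "\<forall>\<^sub>F k in sequentially. (ifs_map F ^^ k) S \<subseteq> set_nbhd e A"
proof -
  have "open U" if "U \<in> {U. conley_nbhd F A U}" for U
    using that by (simp add: conley_nbhd_def)
  then obtain D where D: "D \<subseteq> {U. conley_nbhd F A U}" "finite D" "S \<subseteq> \<Union>D"
    using compactE[OF S[unfolded conley_basin_def]] by metis
  have "\<forall>\<^sub>F k in sequentially. \<forall>U\<in>D. (ifs_map F ^^ k) (closure U) \<subseteq> set_nbhd e A"
    using D(1) e by (intro eventually_ball_finite[OF D(2)]) (auto simp: conley_nbhd_def set_lim_iff)
  then show ?thesis
  proof eventually_elim
    case (elim k)
    have split: "(ifs_map F ^^ k) (\<Union>D) = (\<Union>U\<in>D. (ifs_map F ^^ k) U)"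
      by (induction k) (auto simp: ifs_map_def)
    have "(ifs_map F ^^ k) U \<subseteq> set_nbhd e A" if "U \<in> D" for U
      using elim that ifs_map_funpow_mono[OF closure_subset] by blast
    then show ?case
      using ifs_map_funpow_mono[OF D(3), of k F] unfolding split by blast
  qed
qed

text \<open>The orbits of a point of \<open>A\<close> and of \<open>s\<close> are driven by the same
  word, and each letter contributes a factor \<open>l\<close>. Membership in \<open>B\<close> is
  carried along because the contraction estimate is available only there.\<close>

lemma ifs_map_funpow_contraction:
  assumes inv: "\<And>f x. f \<in> F \<Longrightarrow> x \<in> B \<Longrightarrow> f x \<in> B"
    and contr: "\<And>f x y. f \<in> F \<Longrightarrow> x \<in> B \<Longrightarrow> y \<in> B \<Longrightarrow> d (f x) (f y) \<le> l * d x y"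
    and l: "0 \<le> (l::real)"
    and A: "A \<subseteq> B" and s: "s \<in> B" and bd: "\<And>x. x \<in> A \<Longrightarrow> d x s \<le> D"
    and a: "a \<in> (ifs_map F ^^ k) A"
  shows "\<exists>y\<in>(ifs_map F ^^ k) {s}. a \<in> B \<and> y \<in> B \<and> d a y \<le> l ^ k * D"
  using a
proof (induction k arbitrary: a)
  case 0
  then show ?case
    using A s bd by auto
next
  case (Suc k)
  then obtain f x where f: "f \<in> F" "x \<in> (ifs_map F ^^ k) A" "a = f x"
    unfolding funpow.simps comp_apply ifs_map_def[of F "(ifs_map F ^^ k) A"] by blast
  then obtain y where y: "y \<in> (ifs_map F ^^ k) {s}" "x \<in> B" "y \<in> B" "d x y \<le> l ^ k * D"
    using Suc.IH by blast
  have "d a (f y) \<le> l * d x y"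
    using contr f y by simp
  also have "\<dots> \<le> l * (l ^ k * D)"
    using l y(4) by (rule mult_left_mono[rotated])
  finally have "d a (f y) \<le> l ^ Suc k * D"
    by simp
  moreover have "f y \<in> (ifs_map F ^^ Suc k) {s}"
    using f y by (auto simp: ifs_map_def)
  ultimately show ?case
    using inv f y by blast
qed

text \<open>A finite \<open>e/2\<close>-net of \<open>A\<close> turns pointwise approximation, with
  a rate depending on the point, into a uniform one.\<close>

lemma compact_eventually_subset_set_nbhd:
  assumes A: "compact A"
    and pw: "\<And>a e. a \<in> A \<Longrightarrow> e > 0 \<Longrightarrow> \<forall>\<^sub>F k in sequentially. \<exists>y\<in>S k. dist a y < e"
    and e: "e > 0"
  shows "\<forall>\<^sub>F k in sequentially. A \<subseteq> set_nbhd e (S k)"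
proof -
  obtain T where T: "finite T" "T \<subseteq> A" "A \<subseteq> (\<Union>x\<in>T. ball x (e/2))"
    using compactE_image[OF A, of A "\<lambda>x. ball x (e/2)"] e
    by (metis UN_I centre_in_ball half_gt_zero open_ball subsetI)
  have "\<forall>\<^sub>F k in sequentially. \<forall>x\<in>T. \<exists>y\<in>S k. dist x y < e/2"
    using T(1,2) pw[of _ "e/2"] e half_gt_zero by (intro eventually_ball_finite) blast+
  then show ?thesis
  proof eventually_elim
    case (elim k)
    show ?case
    proof
      fix a
      assume "a \<in> A"
      then obtain x where x: "x \<in> T" "dist x a < e/2"
        using T by auto
      then obtain y where y: "y \<in> S k" "dist x y < e/2"
        using elim by blast
      have "dist a y < e"
        using dist_triangle_half_r[OF x(2) y(2)] .
      then show "a \<in> set_nbhd e (S k)"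
        using y by (auto simp: set_nbhd_def)
    qed
  qed
qed

lemma attractor_near_ifs_map_funpow:
  assumes A: "compact A" "A \<subseteq> B" "ifs_map F A = A"
    and inv: "\<And>f x. f \<in> F \<Longrightarrow> x \<in> B \<Longrightarrow> f x \<in> B"
    and contr: "contractive_on F B" and s: "s \<in> S" "S \<subseteq> B" and e: "e > 0"
  shows "\<forall>\<^sub>F k in sequentially. A \<subseteq> set_nbhd e ((ifs_map F ^^ k) S)"
proof -
  obtain d l where M: "Metric_space B d" and top: "Metric_space.mtopology B d = top_of_set B"
    and l: "0 \<le> l" "l < 1"
    and d: "\<And>f x y. f \<in> F \<Longrightarrow> x \<in> B \<Longrightarrow> y \<in> B \<Longrightarrow> d (f x) (f y) \<le> l * d x y"
    using contr unfolding contractive_on_def by blast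
  interpret Metric_space B d
    by (rule M)
  have sB: "s \<in> B"
    using s by blast
  \<comment> \<open>Compactness depends only on the topology, so it carries over to \<open>d\<close>
    and bounds the \<open>d\<close>-distances from \<open>A\<close> to \<open>s\<close>.\<close>
  have "compactin mtopology A"
    unfolding top using A by (simp add: compactin_subtopology)
  then have "mbounded A"
    by (rule compactin_imp_mbounded)
  then have "mbounded (insert s A)"
    using sB by (simp add: mbounded_insert)
  then obtain D where D: "\<And>x. x \<in> A \<Longrightarrow> d x s \<le> D"
    unfolding mbounded_alt by blast
  show ?thesis
  proof (rule compact_eventually_subset_set_nbhd[OF A(1) _ e])
    fix a and e :: real
    assume a: "a \<in> A" and e: "e > 0"
    \<comment> \<open>The metrics agree only topologically, so the radius \<open>r\<close> depends
      on \<open>a\<close>; this is why the estimate is made pointwise.\<close>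
    have "openin mtopology (B \<inter> ball a e)"
      unfolding top by (simp add: openin_open_Int)
    then obtain r where r: "r > 0" "mball a r \<subseteq> B \<inter> ball a e"
      using a A(2) e unfolding openin_mtopology by (meson IntI centre_in_ball subsetD)
    have "(\<lambda>k. l ^ k * D) \<longlonglongrightarrow> 0 * D"
      using l by (intro tendsto_mult tendsto_const LIMSEQ_realpow_zero)
    then have "\<forall>\<^sub>F k in sequentially. l ^ k * D < r"
      using r order_tendstoD(2) by fastforce
    then show "\<forall>\<^sub>F k in sequentially. \<exists>y\<in>(ifs_map F ^^ k) S. dist a y < e"
    proof eventually_elim
      case (elim k)
      \<comment> \<open>Invariance gives \<open>a\<close> a past of any length \<open>k\<close>
        inside \<open>A\<close>, whose word is then applied to \<open>s\<close>.\<close>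
      have ak: "a \<in> (ifs_map F ^^ k) A"
        using a A by (simp add: ifs_map_funpow_fixed)
      have "\<exists>y\<in>(ifs_map F ^^ k) {s}. a \<in> B \<and> y \<in> B \<and> d a y \<le> l ^ k * D"
        by (rule ifs_map_funpow_contraction[where A = A and B = B and F = F and d = d])
          (fact inv d l(1) A(2) sB D ak)+
      then obtain y where y: "y \<in> (ifs_map F ^^ k) {s}" "a \<in> B" "y \<in> B" "d a y \<le> l ^ k * D"
        by blast
      have "y \<in> mball a r"
        using y elim by simp
      moreover have "y \<in> (ifs_map F ^^ k) S"
        using ifs_map_funpow_mono[of "{s}" S k F] y s by blast
      ultimately show ?case
        using r(2) by (meson IntD2 mem_ball subsetD)
    qed
  qed
qed

text \<open>The assumption \<open>A \<noteq> {}\<close> excludes the empty Conley attractor, which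
  by definition is never strict.\<close>

theorem corollary4p2:
  fixes F :: "('a::metric_space \<Rightarrow> 'a) set" and A B :: "'a set"
  assumes "is_IFS F"
    and "conley_attractor F A"
    and "A \<noteq> {}"
    and "B = conley_basin F A"
    and "contractive_on F B"
  shows "strict_attractor F A \<and> is_strict_basin F A B"
proof -
  obtain C where A: "compact A" and C: "conley_nbhd F A C"
    using assms(2) by (auto simp: conley_attractor_def)
  have fixed: "ifs_map F A = A"
    by (rule conley_attractor_invariant[OF assms(1) A C])
  have AB: "A \<subseteq> B" and "open B"
    using C unfolding assms(4) conley_basin_def conley_nbhd_def by auto
  have inv: "f x \<in> B" if "f \<in> F" "x \<in> B" for f x
    using conley_basin_forward_invariant[OF assms(1) A] that assms(4) by blast
  have "set_lim (\<lambda>k. (ifs_map F ^^ k) S) A" if "S \<noteq> {}" "compact S" "S \<subseteq> B" for S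
  proof -
    obtain s where "s \<in> S"
      using \<open>S \<noteq> {}\<close> by blast
    then show ?thesis
      unfolding set_lim_iff
      using ifs_map_funpow_compact_near_attractor[of S F A] that assms(4)
        attractor_near_ifs_map_funpow[of A B F s S] A AB fixed inv assms(5)
      by simp
  qed
  then have "strict_nbhd F A B"
    using AB \<open>open B\<close> by (simp add: strict_nbhd_def)
  then show ?thesis
    using A assms fixed strict_nbhd_subset_conley_basin[OF assms(1) A C]
    by (auto simp: strict_attractor_def is_strict_basin_def)
qed

end
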